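(* Let $\mathbf{A}$ be an involutive Stone algebra and let $\mathbf{B}$ be a perfect paradefinite algebra (PP-algebra). Then $(\mathbf{A}^{\circ})^{\nabla}=\mathbf{A}$ and $(\mathbf{B}^{\nabla})^{\circ}=\mathbf{B}$.
   Context: A De Morgan algebra is a bounded distributive lattice $\langle A;\land,\lor,\top,\bot\rangle$ with a unary operation $\sim$ satisfying ${\sim}{\sim}x\approx x$ and ${\sim}(x\land y)\approx{\sim}x\lor{\sim}y$. An involutive Stone algebra (IS-algebra) is a De Morgan algebra with an additional unary operation $\nabla$ satisfying: $\nabla\bot\approx\bot$; $x\land\nabla x\approx x$; $\nabla(x\land y)\approx\nabla x\land\nabla y$; ${\sim}\nabla x\land\nabla x\approx\bot$. A perfect paradefinite algebra (PP-algebra) is a De Morgan algebra with an additional unary operation $\circ$ satisfying: (PP1) $\circ\circ x\approx\top$; (PP2) $\circ x\approx\circ{\sim}x$; (PP3) $\circ\top\approx\top$; (PP4) $x\land{\sim}x\land\circ x\approx\bot$; (PP5) $\circ(x\land y)\approx(\circ x\lor\circ y)\land(\circ x\lor{\sim}y)\land(\circ y\lor{\sim}x)$. For an IS-algebra $\mathbf{A}$, $\mathbf{A}^{\circ}$ denotes the PP-algebra with the same De Morgan reduct as $\mathbf{A}$ and with $\circ x:={\sim}\nabla(x\land{\sim}x)$. For a PP-algebra $\mathbf{B}$, $\mathbf{B}^{\nabla}$ denotes the IS-algebra with the same De Morgan reduct as $\mathbf{B}$ and with $\nabla x:={\sim}\circ x\lor x$. (It is known that $\mathbf{A}^\circ$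 is indeed a PP-algebra and $\mathbf{B}^\nabla$ is indeed an IS-algebra.) *)

theory Defs
  imports "HOL-Algebra.Congruence" "HOL-Library.FuncSet"
begin

text \<open>
  Algebras are records over a carrier set. Every operation is taken in the extensional function
  space over the carrier, so that it is exactly a set-theoretic operation on the carrier and
  equality of records is equality of algebras: same carrier and same operations.
\<close>

record 'a dm_struct = "'a partial_object" +
  meet :: "'a \<Rightarrow> 'a \<Rightarrow> 'a" (infixl "\<sqinter>\<index>" 70)
  join :: "'a \<Rightarrow> 'a \<Rightarrow> 'a" (infixl "\<squnion>\<index>" 65)
  top_elt :: 'a ("\<top>\<index>")
  bot_elt :: 'a ("\<bottom>\<index>")
  neg :: "'a \<Rightarrow> 'a" ("\<sim>\<index> _" [81] 80)

record 'a is_struct = "'a dm_struct" +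
  nabla :: "'a \<Rightarrow> 'a" ("\<nabla>\<index> _" [81] 80)

text \<open>The perfection operator is written \<open>\<odot>\<close>, as \<open>\<circ>\<close> is function composition.\<close>

record 'a pp_struct = "'a dm_struct" +
  perf :: "'a \<Rightarrow> 'a" ("\<odot>\<index> _" [81] 80)

locale bounded_distributive_lattice =
  fixes A :: "('a, 'm) dm_struct_scheme" (structure)
  assumes meet_fun: "meet A \<in> carrier A \<rightarrow>\<^sub>E carrier A \<rightarrow>\<^sub>E carrier A"
    and join_fun: "join A \<in> carrier A \<rightarrow>\<^sub>E carrier A \<rightarrow>\<^sub>E carrier A"
    and top_closed: "\<top> \<in> carrier A"
    and bot_closed: "\<bottom> \<in> carrier A"
    and meet_comm: "\<lbrakk>x \<in> carrier A; y \<in> carrier A\<rbrakk> \<Longrightarrow> x \<sqinter> y = y \<sqinter> x"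
    and join_comm: "\<lbrakk>x \<in> carrier A; y \<in> carrier A\<rbrakk> \<Longrightarrow> x \<squnion> y = y \<squnion> x"
    and meet_assoc: "\<lbrakk>x \<in> carrier A; y \<in> carrier A; z \<in> carrier A\<rbrakk>
      \<Longrightarrow> (x \<sqinter> y) \<sqinter> z = x \<sqinter> (y \<sqinter> z)"
    and join_assoc: "\<lbrakk>x \<in> carrier A; y \<in> carrier A; z \<in> carrier A\<rbrakk>
      \<Longrightarrow> (x \<squnion> y) \<squnion> z = x \<squnion> (y \<squnion> z)"
    and meet_absorb: "\<lbrakk>x \<in> carrier A; y \<in> carrier A\<rbrakk> \<Longrightarrow> x \<sqinter> (x \<squnion> y) = x"
    and join_absorb: "\<lbrakk>x \<in> carrier A; y \<in> carrier A\<rbrakk> \<Longrightarrow> x \<squnion> (x \<sqinter> y) = x"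
    and meet_join_distrib: "\<lbrakk>x \<in> carrier A; y \<in> carrier A; z \<in> carrier A\<rbrakk>
      \<Longrightarrow> x \<sqinter> (y \<squnion> z) = (x \<sqinter> y) \<squnion> (x \<sqinter> z)"
    and meet_top: "x \<in> carrier A \<Longrightarrow> x \<sqinter> \<top> = x"
    and join_bot: "x \<in> carrier A \<Longrightarrow> x \<squnion> \<bottom> = x"

locale de_morgan_algebra = bounded_distributive_lattice +
  assumes neg_fun: "neg A \<in> carrier A \<rightarrow>\<^sub>E carrier A"
    and neg_neg: "x \<in> carrier A \<Longrightarrow> \<sim>(\<sim>x) = x"
    and neg_meet: "\<lbrakk>x \<in> carrier A; y \<in> carrier A\<rbrakk> \<Longrightarrow> \<sim>(x \<sqinter> y) = \<sim>x \<squnion> \<sim>y"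

locale involutive_stone_algebra = de_morgan_algebra A
  for A :: "('a, 'm) is_struct_scheme" (structure) +
  assumes nabla_fun: "nabla A \<in> carrier A \<rightarrow>\<^sub>E carrier A"
    and nabla_bot: "\<nabla>\<bottom> = \<bottom>"
    and meet_nabla: "x \<in> carrier A \<Longrightarrow> x \<sqinter> \<nabla>x = x"
    and nabla_meet: "\<lbrakk>x \<in> carrier A; y \<in> carrier A\<rbrakk> \<Longrightarrow> \<nabla>(x \<sqinter> y) = \<nabla>x \<sqinter> \<nabla>y"
    and neg_nabla_meet: "x \<in> carrier A \<Longrightarrow> \<sim>(\<nabla>x) \<sqinter> \<nabla>x = \<bottom>"

locale perfect_paradefinite_algebra = de_morgan_algebra A
  for A :: "('a, 'm) pp_struct_scheme" (structure) +
  assumes perf_fun: "perf A \<in> carrier A \<rightarrow>\<^sub>E carrier A"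
    and PP1: "x \<in> carrier A \<Longrightarrow> \<odot>(\<odot>x) = \<top>"
    and PP2: "x \<in> carrier A \<Longrightarrow> \<odot>x = \<odot>(\<sim>x)"
    and PP3: "\<odot>\<top> = \<top>"
    and PP4: "x \<in> carrier A \<Longrightarrow> x \<sqinter> \<sim>x \<sqinter> \<odot>x = \<bottom>"
    and PP5: "\<lbrakk>x \<in> carrier A; y \<in> carrier A\<rbrakk>
      \<Longrightarrow> \<odot>(x \<sqinter> y) = (\<odot>x \<squnion> \<odot>y) \<sqinter> (\<odot>x \<squnion> \<sim>y) \<sqinter> (\<odot>y \<squnion> \<sim>x)"

text \<open>
  \<open>to_pp A\<close> is the algebra \<open>A\<^sup>\<circ>\<close> and \<open>to_is B\<close> is \<open>B\<^sup>\<nabla>\<close>; the new operation is restricted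
  to the carrier to stay in the extensional function space.
\<close>

definition to_pp :: "'a is_struct \<Rightarrow> 'a pp_struct" where
  "to_pp A = \<lparr>carrier = carrier A, meet = meet A, join = join A,
     top_elt = top_elt A, bot_elt = bot_elt A, neg = neg A,
     perf = (\<lambda>x\<in>carrier A. \<sim>\<^bsub>A\<^esub> (\<nabla>\<^bsub>A\<^esub> (x \<sqinter>\<^bsub>A\<^esub> \<sim>\<^bsub>A\<^esub> x)))\<rparr>"

definition to_is :: "'a pp_struct \<Rightarrow> 'a is_struct" where
  "to_is B = \<lparr>carrier = carrier B, meet = meet B, join = join B,
     top_elt = top_elt B, bot_elt = bot_elt B, neg = neg B,
     nabla = (\<lambda>x\<in>carrier B. \<sim>\<^bsub>B\<^esub> (\<odot>\<^bsub>B\<^esub> x) \<squnion>\<^bsub>B\<^esub> x)\<rparr>"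

end

theory Submission
  imports Defs
begin

text \<open>
  Both round trips rest on the Boolean elements of a De Morgan algebra, those \<open>a\<close> with
  \<open>a \<sqinter> \<sim>a = \<bottom>\<close>. De Morgan duality turns this equation into \<open>\<sim>a \<squnion> a = \<top>\<close>, so that \<open>\<sim>a\<close> is a
  lattice complement of \<open>a\<close>. The values of \<open>\<nabla>\<close> are Boolean by axiom, and so are those of \<open>\<odot>\<close>,
  by (PP4) at \<open>\<odot>x\<close>, since \<open>\<odot>(\<odot>x) = \<top>\<close>.

  Starting from an involutive Stone algebra, the double translation sends \<open>x\<close> to
  \<open>\<nabla>(x \<sqinter> \<sim>x) \<squnion> x = (\<nabla>x \<sqinter> \<nabla>(\<sim>x)) \<squnion> (\<nabla>x \<sqinter> x) = \<nabla>x \<sqinter> (\<nabla>(\<sim>x) \<squnion> x)\<close>. Here \<open>\<sim>x \<le> \<nabla>(\<sim>x)\<close>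
  gives \<open>\<sim>(\<nabla>(\<sim>x)) \<le> x\<close>, so the Boolean element \<open>\<nabla>(\<sim>x)\<close> already joins with \<open>x\<close> to \<open>\<top>\<close> and the
  value is \<open>\<nabla>x\<close>.

  Starting from a PP-algebra, the double translation sends \<open>x\<close> to \<open>\<odot>(x \<sqinter> \<sim>x) \<sqinter> (\<sim>x \<squnion> x)\<close>. By
  (PP2), (PP5) at \<open>x, \<sim>x\<close> collapses to \<open>\<odot>(x \<sqinter> \<sim>x) = \<odot>x\<close>. The second factor is absorbed: the
  De Morgan dual of (PP4) puts \<open>\<odot>x\<close> below \<open>(\<sim>x \<squnion> x) \<squnion> \<sim>(\<odot>x)\<close>, and \<open>\<odot>x\<close>, being Boolean, is
  disjoint from \<open>\<sim>(\<odot>x)\<close>.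
\<close>

context bounded_distributive_lattice
begin

lemma meet_closed: "\<lbrakk>x \<in> carrier A; y \<in> carrier A\<rbrakk> \<Longrightarrow> x \<sqinter> y \<in> carrier A"
  using meet_fun by (blast dest: PiE_mem)

lemma join_closed: "\<lbrakk>x \<in> carrier A; y \<in> carrier A\<rbrakk> \<Longrightarrow> x \<squnion> y \<in> carrier A"
  using join_fun by (blast dest: PiE_mem)

lemma meet_bot:
  assumes "x \<in> carrier A"
  shows "\<bottom> \<sqinter> x = \<bottom>"
  using meet_absorb[OF bot_closed assms] join_comm[OF bot_closed assms] join_bot[OF assms] by simp

lemma join_top:
  assumes "x \<in> carrier A"
  shows "x \<squnion> \<top> = \<top>"
  using join_absorb[OF top_closed assms] meet_comm[OF top_closed assms] meet_top[OF assms]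
    join_comm[OF top_closed assms] by simp

lemma join_idem:
  assumes "x \<in> carrier A"
  shows "x \<squnion> x = x"
  using join_absorb[OF assms top_closed] meet_top[OF assms] by simp

end

context de_morgan_algebra
begin

lemma neg_closed: "x \<in> carrier A \<Longrightarrow> \<sim>x \<in> carrier A"
  using neg_fun by (rule PiE_mem)

lemma neg_join:
  assumes "x \<in> carrier A" "y \<in> carrier A"
  shows "\<sim>(x \<squnion> y) = \<sim>x \<sqinter> \<sim>y"
proof -
  have "\<sim>(\<sim>x \<sqinter> \<sim>y) = x \<squnion> y"
    using assms by (simp add: neg_meet neg_neg neg_closed)
  then show ?thesis
    using neg_neg[of "\<sim>x \<sqinter> \<sim>y"] assms by (simp add: neg_closed meet_closed)
qed

lemma neg_bot: "\<sim>\<bottom> = \<top>"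
proof -
  have "\<bottom> = \<bottom> \<sqinter> \<sim>\<top>"
    by (simp add: meet_bot neg_closed top_closed)
  then have "\<sim>\<bottom> = \<sim>\<bottom> \<squnion> \<top>"
    by (metis bot_closed neg_closed neg_meet neg_neg top_closed)
  then show ?thesis
    by (simp add: join_top neg_closed bot_closed)
qed

end

context involutive_stone_algebra
begin

lemma nabla_closed: "x \<in> carrier A \<Longrightarrow> \<nabla>x \<in> carrier A"
  using nabla_fun by (rule PiE_mem)

text \<open>
  The complement \<open>\<sim>(\<nabla>(\<sim>x))\<close> of \<open>\<nabla>(\<sim>x)\<close> lies below \<open>x\<close>, because \<open>\<sim>\<close> reverses
  \<open>\<sim>x \<le> \<nabla>(\<sim>x)\<close>; the join with \<open>x\<close> is thus at least as large as the join with the complement.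
\<close>

lemma nabla_neg_join:
  assumes x: "x \<in> carrier A"
  shows "\<nabla>(\<sim>x) \<squnion> x = \<top>"
proof -
  let ?n = "\<nabla>(\<sim>x)"
  have n: "?n \<in> carrier A" "\<sim>?n \<in> carrier A"
    using x by (simp_all add: nabla_closed neg_closed)
  have "\<sim>(\<sim>?n \<sqinter> ?n) = \<top>"
    using x by (simp add: neg_nabla_meet neg_closed neg_bot)
  then have complement: "?n \<squnion> \<sim>?n = \<top>"
    using n by (simp add: neg_meet neg_neg)
  have "\<sim>(\<sim>x \<sqinter> ?n) = \<sim>(\<sim>x)"
    using x by (simp add: meet_nabla neg_closed)
  then have "x \<squnion> \<sim>?n = x"
    using x n by (simp add: neg_meet neg_neg neg_closed)
  then have "?n \<squnion> x = ?n \<squnion> (\<sim>?n \<squnion> x)"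
    using x n by (simp add: join_comm)
  also have "\<dots> = x \<squnion> \<top>"
    using x n complement by (metis join_assoc join_comm top_closed)
  finally show ?thesis
    using x by (simp add: join_top)
qed

lemma nabla_of_perfection:
  assumes x: "x \<in> carrier A"
  shows "\<sim>(\<sim>(\<nabla>(x \<sqinter> \<sim>x))) \<squnion> x = \<nabla>x"
proof -
  have "\<sim>(\<sim>(\<nabla>(x \<sqinter> \<sim>x))) = \<nabla>x \<sqinter> \<nabla>(\<sim>x)"
    using x by (simp add: neg_neg nabla_meet nabla_closed neg_closed meet_closed)
  moreover have "\<nabla>x \<sqinter> x = x"
    using x by (simp add: meet_comm meet_nabla nabla_closed)
  ultimately have "\<sim>(\<sim>(\<nabla>(x \<sqinter> \<sim>x))) \<squnion> x = \<nabla>x \<sqinter> (\<nabla>(\<sim>x) \<squnion> x)"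
    using x by (simp add: meet_join_distrib nabla_closed neg_closed)
  then show ?thesis
    using x by (simp add: nabla_neg_join meet_top nabla_closed)
qed

end

context perfect_paradefinite_algebra
begin

lemma perf_closed: "x \<in> carrier A \<Longrightarrow> \<odot>x \<in> carrier A"
  using perf_fun by (rule PiE_mem)

lemma perf_meet_neg_perf:
  assumes "x \<in> carrier A"
  shows "\<odot>x \<sqinter> \<sim>(\<odot>x) = \<bottom>"
  using PP4[of "\<odot>x"] assms by (simp add: PP1 meet_top perf_closed neg_closed meet_closed)

text \<open>
  With \<open>y = \<sim>x\<close>, (PP2) makes the two perfection terms of (PP5) equal, so its first factor is
  \<open>\<odot>x\<close>, which absorbs the other two.
\<close>

lemma perf_meet_neg:
  assumes x: "x \<in> carrier A"
  shows "\<odot>(x \<sqinter> \<sim>x) = \<odot>x"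
proof -
  have "\<odot>(x \<sqinter> \<sim>x) = (\<odot>x \<squnion> \<odot>x) \<sqinter> (\<odot>x \<squnion> x) \<sqinter> (\<odot>x \<squnion> \<sim>x)"
    using PP5[of x "\<sim>x"] PP2[of x] x by (simp add: neg_closed neg_neg)
  then show ?thesis
    using x by (simp add: join_idem meet_absorb perf_closed neg_closed)
qed

text \<open>
  This is the inequality \<open>\<odot>x \<le> \<sim>x \<squnion> x\<close>. The dual of (PP4) covers \<open>\<top>\<close> by \<open>\<sim>x \<squnion> x\<close> and \<open>\<sim>(\<odot>x)\<close>,
  and \<open>\<odot>x\<close> does not meet the second part.
\<close>

lemma perf_meet_excluded_middle:
  assumes x: "x \<in> carrier A"
  shows "\<odot>x \<sqinter> (\<sim>x \<squnion> x) = \<odot>x"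
proof -
  have p: "\<odot>x \<in> carrier A" "\<sim>(\<odot>x) \<in> carrier A" "\<sim>x \<squnion> x \<in> carrier A"
    using x by (simp_all add: perf_closed neg_closed join_closed)
  have "\<sim>(x \<sqinter> \<sim>x \<sqinter> \<odot>x) = \<top>"
    using x by (simp add: PP4 neg_bot)
  then have cover: "(\<sim>x \<squnion> x) \<squnion> \<sim>(\<odot>x) = \<top>"
    using x by (simp add: neg_meet neg_neg neg_closed meet_closed perf_closed)
  have "\<odot>x = \<odot>x \<sqinter> ((\<sim>x \<squnion> x) \<squnion> \<sim>(\<odot>x))"
    using p by (simp add: cover meet_top)
  also have "\<dots> = (\<odot>x \<sqinter> (\<sim>x \<squnion> x)) \<squnion> \<bottom>"
    using x p by (simp add: meet_join_distrib perf_meet_neg_perf)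
  also have "\<dots> = \<odot>x \<sqinter> (\<sim>x \<squnion> x)"
    using p by (simp add: join_bot meet_closed)
  finally show ?thesis ..
qed

lemma perfection_of_nabla:
  assumes x: "x \<in> carrier A"
  shows "\<sim>(\<sim>(\<odot>(x \<sqinter> \<sim>x)) \<squnion> (x \<sqinter> \<sim>x)) = \<odot>x"
  using x by (simp add: perf_meet_neg neg_join neg_meet neg_neg perf_meet_excluded_middle
      perf_closed neg_closed meet_closed)

end

text \<open>
  The translated operations are restricted to the carrier, so an equation between them holds
  everywhere as soon as it holds on the carrier, the original operations being extensional.
\<close>

lemma to_is_to_pp:
  assumes "involutive_stone_algebra A"
  shows "to_is (to_pp A) = A"
proof -
  interpret involutive_stone_algebra A by fact
  have "(\<lambda>x\<in>carrier A. \<sim>\<^bsub>A\<^esub> (\<sim>\<^bsub>A\<^esub> (\<nabla>\<^bsub>A\<^esub> (x \<sqinter>\<^bsub>A\<^esub> \<sim>\<^bsub>A\<^esub> x))) \<squnion>\<^bsub>A\<^esub> x)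
      = restrict (nabla A) (carrier A)"
    by (rule restrict_ext) (rule nabla_of_perfection)
  also have "\<dots> = nabla A"
    using nabla_fun by (simp add: PiE_def extensional_restrict)
  finally show ?thesis
    by (simp add: to_is_def to_pp_def cong: restrict_cong)
qed

lemma to_pp_to_is:
  assumes "perfect_paradefinite_algebra B"
  shows "to_pp (to_is B) = B"
proof -
  interpret perfect_paradefinite_algebra B by fact
  have "(\<lambda>x\<in>carrier B. \<sim>\<^bsub>B\<^esub> (\<sim>\<^bsub>B\<^esub> (\<odot>\<^bsub>B\<^esub> (x \<sqinter>\<^bsub>B\<^esub> \<sim>\<^bsub>B\<^esub> x)) \<squnion>\<^bsub>B\<^esub> (x \<sqinter>\<^bsub>B\<^esub> \<sim>\<^bsub>B\<^esub> x)))
      = restrict (perf B) (carrier B)"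
    by (rule restrict_ext) (rule perfection_of_nabla)
  also have "\<dots> = perf B"
    using perf_fun by (simp add: PiE_def extensional_restrict)
  finally show ?thesis
    by (simp add: to_is_def to_pp_def meet_closed neg_closed cong: restrict_cong)
qed

theorem theorem3p6:
  fixes A :: "'a is_struct" and B :: "'b pp_struct"
  assumes "involutive_stone_algebra A"
    and "perfect_paradefinite_algebra B"
  shows "to_is (to_pp A) = A \<and> to_pp (to_is B) = B"
  using assms by (simp add: to_is_to_pp to_pp_to_is)

end
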